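(* Let $\Lambda$ be the erasing channel on a qubit with reference basis $\{|0\rangle,|1\rangle\}$, i.e. $\Lambda[\rho]=|0\rangle\langle 0|$ for every qubit state $\rho$. With respect to the relative entropy of coherence, its complete decohering power is $\mathfrak{D}_r(\Lambda)=2$ and its generalized decohering power is $\mathscr{D}_r(\Lambda)=1$; in particular $\mathscr{D}_r(\Lambda)<\mathfrak{D}_r(\Lambda)$.
   Context: All Hilbert spaces are finite-dimensional complex, and each system has a fixed orthonormal reference basis $\{|i\rangle\}$; for a bipartite system the reference basis is the product of the local reference bases. A state is a positive semidefinite operator of trace one; $\Lambda$ is extended linearly to all operators by $\Lambda[X]=\mathrm{Tr}[X]\,|0\rangle\langle0|$. $S(\rho)=-\mathrm{Tr}[\rho\log_2\rho]$ is the von Neumann entropy and $\Delta[\rho]=\sum_i\langle i|\rho|i\rangle\,|i\rangle\langle i|$ is complete dephasing in the reference basis. The relative entropy of coherence is $$C_r(\rho)=\min_{\sigma\in\mathcal{I}}S(\rho\|\sigma)=S(\Delta[\rho])-S(\rho),$$ where $\mathcal{I}$ is the set of states diagonal in the reference basis and $S(\rho\|\sigma)=\mathrm{Tr}[\rho\log_2\rho]-\mathrm{Tr}[\rho\log_2\sigma]$. $\mathbb{1}_k$ denotes the identity channel on a system $B$ of dimension $k$. For a quantum channel $\Phi$ on a system $A$, the generalized decohering power is $\mathscr{D}_r(\Phi)=\sup_\rho\{C_r(\rho)-C_r(\Phi[\rho])\}$ over all states $\rho$ of $A$, and the complete decohering power is $\mathfrak{D}_r(\Phi)=\sup_{k}\sup_{\rho^{AB}}\{C_r(\rho^{AB})-C_r(\Phi\otimes\mathbb{1}_k[\rho^{AB}])\}$,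 with $\rho^{AB}$ ranging over all states of $A\otimes B$, $\dim B=k$. *)

theory Defs
  imports "Jordan_Normal_Form.Schur_Decomposition" "HOL-Library.Extended_Real"
begin

text \<open>Operators on an \<open>n\<close>-dimensional system are matrices in \<open>carrier_mat n n\<close>, written in
  the reference basis of the system.\<close>

definition mat_trace :: "complex mat \<Rightarrow> complex" where
  "mat_trace A = (\<Sum>i<dim_row A. A $$ (i, i))"

definition psd :: "nat \<Rightarrow> complex mat \<Rightarrow> bool" where
  "psd n A \<longleftrightarrow> A \<in> carrier_mat n n \<and> mat_adjoint A = A \<and>
     (\<forall>v \<in> carrier_vec n. 0 \<le> Re ((A *\<^sub>v v) \<bullet>c v))"

definition states :: "nat \<Rightarrow> complex mat set" where
  "states n = {\<rho>. psd n \<rho> \<and> mat_trace \<rho> = 1}"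

definition incoherent_states :: "nat \<Rightarrow> complex mat set" where
  "incoherent_states n = {\<sigma> \<in> states n. diagonal_mat \<sigma>}"

definition unitary :: "nat \<Rightarrow> complex mat \<Rightarrow> bool" where
  "unitary n U \<longleftrightarrow> U \<in> carrier_mat n n \<and>
     inverts_mat U (mat_adjoint U) \<and> inverts_mat (mat_adjoint U) U"

text \<open>Functional calculus for Hermitian matrices. The result does not depend on the chosen
  diagonalization, so the description is well defined on every Hermitian matrix.\<close>

definition spectral_fun :: "(real \<Rightarrow> real) \<Rightarrow> complex mat \<Rightarrow> complex mat" where
  "spectral_fun f A = (THE B. \<exists>U d. unitary (dim_row A) U \<and>
     A = U * mat_diag (dim_row A) (\<lambda>i. complex_of_real (d i)) * mat_adjoint U \<and>
     B = U * mat_diag (dim_row A) (\<lambda>i. complex_of_real (f (d i))) * mat_adjoint U)"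

text \<open>The logarithm of a positive semidefinite matrix is taken on its support and is zero on
  its kernel. This gives the convention \<open>0 log 0 = 0\<close>.\<close>

definition mat_log2 :: "complex mat \<Rightarrow> complex mat" where
  "mat_log2 = spectral_fun (\<lambda>x. if x = 0 then 0 else log 2 x)"

text \<open>The relative entropy is infinite unless the support of \<open>\<rho>\<close> lies in that of \<open>\<sigma>\<close>,
  i.e. unless the kernel of \<open>\<sigma>\<close> lies in that of \<open>\<rho>\<close>.\<close>

definition rel_entropy :: "complex mat \<Rightarrow> complex mat \<Rightarrow> ereal" where
  "rel_entropy \<rho> \<sigma> =
     (if \<forall>v \<in> carrier_vec (dim_row \<rho>). \<sigma> *\<^sub>v v = 0\<^sub>v (dim_row \<rho>) \<longrightarrow> \<rho> *\<^sub>v v = 0\<^sub>v (dim_row \<rho>)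
      then ereal (Re (mat_trace (\<rho> * mat_log2 \<rho>) - mat_trace (\<rho> * mat_log2 \<sigma>)))
      else \<infinity>)"

text \<open>For a state \<open>\<rho>\<close> the infimum below is attained (at the dephased state) and is finite, so
  the differences in the decohering powers are never of the form \<open>\<infinity> - \<infinity>\<close>.\<close>

definition rel_ent_coherence :: "complex mat \<Rightarrow> ereal" where
  "rel_ent_coherence \<rho> = (INF \<sigma> \<in> incoherent_states (dim_row \<rho>). rel_entropy \<rho> \<sigma>)"

text \<open>The map \<open>\<Phi> \<otimes> id\<close> on a bipartite system with local dimensions \<open>n\<close> and \<open>k\<close>. The product
  basis vector \<open>|a\<rangle>|b\<rangle>\<close> has index \<open>a * k + b\<close>, and \<open>\<Phi>\<close> acts on each of the \<open>n\<close> by \<open>n\<close> blocks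
  \<open>\<langle>b|X|b'\<rangle>\<close>.\<close>

definition block_B :: "nat \<Rightarrow> nat \<Rightarrow> complex mat \<Rightarrow> nat \<Rightarrow> nat \<Rightarrow> complex mat" where
  "block_B n k X b b' = Matrix.mat n n (\<lambda>(a, a'). X $$ (a * k + b, a' * k + b'))"

definition tensor_id ::
  "nat \<Rightarrow> nat \<Rightarrow> (complex mat \<Rightarrow> complex mat) \<Rightarrow> complex mat \<Rightarrow> complex mat" where
  "tensor_id n k \<Phi> X = Matrix.mat (n * k) (n * k)
     (\<lambda>(i, j). \<Phi> (block_B n k X (i mod k) (j mod k)) $$ (i div k, j div k))"

text \<open>Decohering powers of a channel \<open>\<Phi>\<close> on an \<open>n\<close>-dimensional system, given as a linear map on
  \<open>carrier_mat n n\<close>.\<close>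

definition gen_decohering_power :: "nat \<Rightarrow> (complex mat \<Rightarrow> complex mat) \<Rightarrow> ereal" where
  "gen_decohering_power n \<Phi> =
     (SUP \<rho> \<in> states n. rel_ent_coherence \<rho> - rel_ent_coherence (\<Phi> \<rho>))"

definition complete_decohering_power :: "nat \<Rightarrow> (complex mat \<Rightarrow> complex mat) \<Rightarrow> ereal" where
  "complete_decohering_power n \<Phi> =
     (SUP k \<in> {1..}. SUP \<rho> \<in> states (n * k).
        rel_ent_coherence \<rho> - rel_ent_coherence (tensor_id n k \<Phi> \<rho>))"

definition erasing_channel :: "complex mat \<Rightarrow> complex mat" where
  "erasing_channel X =
     mat_trace X \<cdot>\<^sub>m Matrix.mat 2 2 (\<lambda>(i, j). if i = 0 \<and> j = 0 then 1 else 0)"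

end

theory Submission
  imports Defs "Jordan_Normal_Form.Spectral_Radius"
begin

text \<open>
  Gibbs' inequality gives \<open>C\<^sub>r(\<rho>) = S(\<Delta>[\<rho>]) - S(\<rho>)\<close>. If \<open>\<rho> = \<Sum>\<^sub>j |w\<^sub>j\<rangle>\<langle>w\<^sub>j|\<close> with unnormalised
  \<open>w\<^sub>j\<close>, then \<open>S(\<rho>)\<close> is at most the Shannon entropy of the weights \<open>\<parallel>w\<^sub>j\<parallel>\<^sup>2\<close>. Cutting every
  eigenvector of \<open>\<rho>\<^sup>A\<^sup>B\<close> into its two \<open>B\<close>-components yields such a decomposition of \<open>\<rho>\<^sup>B\<close>, and
  splitting a weight in two raises its entropy by at most the weight itself, so
  \<open>S(\<rho>\<^sup>B) \<le> S(\<rho>\<^sup>A\<^sup>B) + 1\<close>. The same splitting on the diagonal gives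
  \<open>S(\<Delta>[\<rho>\<^sup>A\<^sup>B]) \<le> S(\<Delta>[\<rho>\<^sup>B]) + 1\<close>, hence the bound 2. It is attained at the maximally entangled
  two-qubit vector \<open>(1, 1, 1, -1)/2\<close>, whose coherence is 2 and whose marginal is maximally mixed.
\<close>

section \<open>The spectral theorem\<close>

lemma mat_adjoint_carrier:
  "A \<in> carrier_mat n m \<Longrightarrow> mat_adjoint A \<in> carrier_mat m n"
  unfolding mat_adjoint_def by (auto simp: mat_of_rows_def)

lemma dim_mat_adjoint [simp]:
  "dim_row (mat_adjoint A) = dim_col A" "dim_col (mat_adjoint A) = dim_row A"
  unfolding mat_adjoint_def by auto

lemma index_mat_adjoint:
  fixes A :: "complex mat"
  assumes "A \<in> carrier_mat n m" "i < m" "j < n"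
  shows "mat_adjoint A $$ (i, j) = cnj (A $$ (j, i))"
  using assms unfolding mat_adjoint_def by (auto simp: mat_of_rows_def)

lemma mat_adjoint_adjoint:
  fixes A :: "complex mat"
  assumes "A \<in> carrier_mat n m"
  shows "mat_adjoint (mat_adjoint A) = A"
proof (rule eq_matI)
  fix i j assume "i < dim_row A" "j < dim_col A"
  then show "mat_adjoint (mat_adjoint A) $$ (i, j) = A $$ (i, j)"
    using assms by (simp add: index_mat_adjoint[OF mat_adjoint_carrier[OF assms]] index_mat_adjoint[OF assms])
qed simp_all

lemma mat_adjoint_mult:
  fixes A B :: "complex mat"
  assumes "A \<in> carrier_mat n m" "B \<in> carrier_mat m k"
  shows "mat_adjoint (A * B) = mat_adjoint B * mat_adjoint A"
proof (rule eq_matI)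
  fix i j assume "i < dim_row (mat_adjoint B * mat_adjoint A)" "j < dim_col (mat_adjoint B * mat_adjoint A)"
  then have "i < k" "j < n" using assms by auto
  then show "mat_adjoint (A * B) $$ (i, j) = (mat_adjoint B * mat_adjoint A) $$ (i, j)"
    using assms mat_adjoint_carrier[OF assms(1)] mat_adjoint_carrier[OF assms(2)]
      mult_carrier_mat[OF assms]
    by (auto simp: index_mat_adjoint[of _ n k] scalar_prod_def index_mat_adjoint[OF assms(1)]
        index_mat_adjoint[OF assms(2)] mult.commute intro!: sum.cong)
qed simp_all

lemma unitaryI:
  assumes "U \<in> carrier_mat n n" "mat_adjoint U * U = 1\<^sub>m n"
  shows "unitary n U"
proof -
  have "U * mat_adjoint U = 1\<^sub>m n"
    using mat_mult_left_right_inverse[OF mat_adjoint_carrier[OF assms(1)] assms(1) assms(2)] .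
  moreover have "dim_row (mat_adjoint U) = n"
    using mat_adjoint_carrier[OF assms(1)] by auto
  ultimately show ?thesis using assms unfolding unitary_def inverts_mat_def by auto
qed

lemma unitaryD:
  assumes "unitary n U"
  shows "U \<in> carrier_mat n n" "mat_adjoint U \<in> carrier_mat n n"
    "mat_adjoint U * U = 1\<^sub>m n" "U * mat_adjoint U = 1\<^sub>m n"
proof -
  show U: "U \<in> carrier_mat n n" using assms unfolding unitary_def by auto
  then show U': "mat_adjoint U \<in> carrier_mat n n" by (rule mat_adjoint_carrier)
  show "mat_adjoint U * U = 1\<^sub>m n" "U * mat_adjoint U = 1\<^sub>m n"
    using assms U U' unfolding unitary_def inverts_mat_def by auto
qed

lemma unitary_one: "unitary n (1\<^sub>m n)"
proof -
  have "mat_adjoint (1\<^sub>m n :: complex mat) = 1\<^sub>m n"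
    by (rule eq_matI) (auto simp: index_mat_adjoint[OF one_carrier_mat])
  then show ?thesis by (intro unitaryI) auto
qed

lemma unitary_mult:
  assumes U: "unitary n U" and V: "unitary n V"
  shows "unitary n (U * V)"
proof (rule unitaryI)
  note u = unitaryD[OF U] and v = unitaryD[OF V]
  show "U * V \<in> carrier_mat n n" using u v by simp
  have "mat_adjoint (U * V) * (U * V) = mat_adjoint V * (mat_adjoint U * (U * V))"
    using u v by (simp add: mat_adjoint_mult[OF u(1) v(1)] assoc_mult_mat[of _ n n _ n _ n])
  also have "mat_adjoint U * (U * V) = V"
    using u v by (simp add: assoc_mult_mat[of _ n n _ n _ n, symmetric])
  finally show "mat_adjoint (U * V) * (U * V) = 1\<^sub>m n" using v by simp
qed

section \<open>Diagonalization of Hermitian matrices\<close>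

text \<open>Complete \<open>v\<close> to a basis and orthogonalise it: Gram-Schmidt leaves the first
  vector of the list unchanged, so after normalising the columns the first one is \<open>v\<close>
  divided by its norm.\<close>

lemma unitary_with_first_column:
  fixes v :: "complex vec"
  assumes v: "v \<in> carrier_vec n" "v \<noteq> 0\<^sub>v n"
  shows "\<exists>W c. unitary n W \<and> col W 0 = c \<cdot>\<^sub>v v"
proof -
  interpret cof_vec_space n "TYPE(complex)" .
  have n: "0 < n" using v by (cases n) auto
  define b where "b = basis_completion v"
  note b = basis_completion[OF v, folded b_def]
  define ws where "ws = gram_schmidt n b"
  from b have "length b = n" "hd b = v" by auto
  then obtain vs where bv: "b = v # vs" using n by (cases b) auto
  from gram_schmidt_result[OF b(2) b(4) b(5) refl, folded ws_def]
  have ws: "set ws \<subseteq> carrier_vec n" "corthogonal ws" "length ws = n" using b by auto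
  from gram_schmidt_hd[OF v(1), of vs, folded bv] have "hd ws = v" unfolding ws_def .
  then have ws0: "ws ! 0 = v" using ws n by (cases ws) auto
  have wsc: "ws ! i \<in> carrier_vec n" if "i < n" for i using ws that by auto
  define N where "N i = sqrt (\<Sum>l<n. (cmod (ws ! i $ l))\<^sup>2)" for i
  have ip: "ws ! i \<bullet>c ws ! j = (\<Sum>l<n. ws ! i $ l * cnj (ws ! j $ l))" if "i < n" "j < n" for i j
    using wsc[OF that(1)] wsc[OF that(2)]
    by (auto simp: scalar_prod_def atLeast0LessThan intro!: sum.cong)
  have sq: "ws ! i \<bullet>c ws ! i = complex_of_real ((N i)\<^sup>2)" if "i < n" for i
    using ip[OF that that] by (simp add: N_def sum_nonneg complex_norm_square[symmetric] flip: of_real_power)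
  \<comment> \<open>\<open>corthogonal\<close> includes that every self inner product is nonzero, so
    division by these norms is legitimate.\<close>
  have N: "N i \<noteq> 0" if "i < n" for i
    using sq[OF that] corthogonalD[OF ws(2), of i i] ws(3) that by auto
  define W where "W = Matrix.mat n n (\<lambda>(i, j). ws ! j $ i / complex_of_real (N j))"
  have W: "W \<in> carrier_mat n n" unfolding W_def by simp
  have "unitary n W"
  proof (rule unitaryI[OF W], rule eq_matI)
    fix i j assume "i < dim_row (1\<^sub>m n :: complex mat)" "j < dim_col (1\<^sub>m n :: complex mat)"
    then have ij: "i < n" "j < n" by auto
    have "(mat_adjoint W * W) $$ (i, j) = (\<Sum>l<n. cnj (W $$ (l, i)) * W $$ (l, j))"
      using W mat_adjoint_carrier[OF W] ij
      by (auto simp: scalar_prod_def index_mat_adjoint[OF W] atLeast0LessThan intro!: sum.cong)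
    also have "\<dots> = (\<Sum>l<n. (ws ! j $ l * cnj (ws ! i $ l)) / (complex_of_real (N i) * complex_of_real (N j)))"
      using ij by (intro sum.cong) (auto simp: W_def field_simps)
    also have "\<dots> = (ws ! j \<bullet>c ws ! i) / (complex_of_real (N i) * complex_of_real (N j))"
      using ip[OF ij(2) ij(1)] by (simp add: sum_divide_distrib)
    also have "\<dots> = (if i = j then 1 else 0)"
    proof (cases "i = j")
      case True
      then show ?thesis using sq[OF ij(1)] N[OF ij(1)] by (simp add: power2_eq_square)
    next
      case False
      then have "ws ! j \<bullet>c ws ! i = 0" using corthogonalD[OF ws(2), of j i] ws(3) ij by auto
      then show ?thesis using False by simp
    qed
    finally show "(mat_adjoint W * W) $$ (i, j) = 1\<^sub>m n $$ (i, j)" using ij by simp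
  qed (use W mat_adjoint_carrier[OF W] in auto)
  moreover have "col W 0 = (1 / complex_of_real (N 0)) \<cdot>\<^sub>v v"
    using n v(1) by (intro eq_vecI) (auto simp: W_def ws0)
  ultimately show ?thesis by blast
qed

text \<open>Induction on the dimension by deflation. When the first column of \<open>W\<close> is an
  eigenvector, the conjugate \<open>M\<close> of \<open>A\<close> by \<open>W\<close> has
  \<open>e\<close> times the first unit vector as its first column. Since \<open>M\<close> is
  Hermitian, \<open>e\<close> is real and the first row vanishes off the diagonal too, which leaves
  a Hermitian block of size \<open>m\<close> for the induction hypothesis.\<close>

lemma hermitian_diagonalizable:
  fixes A :: "complex mat"
  assumes "A \<in> carrier_mat n n" "mat_adjoint A = A"
  shows "\<exists>U d. unitary n U \<and> A = U * mat_diag n (\<lambda>i. complex_of_real (d i)) * mat_adjoint U"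
  using assms
proof (induction n arbitrary: A)
  case 0
  have "A = 1\<^sub>m 0 * mat_diag 0 (\<lambda>i. complex_of_real 0) * mat_adjoint (1\<^sub>m 0)"
    using 0 by (intro eq_matI) auto
  then show ?case using unitary_one[of 0] by (intro exI[of _ "1\<^sub>m 0"] exI[of _ "\<lambda>_. 0"]) simp
next
  case (Suc m)
  let ?n = "Suc m"
  note A = Suc.prems(1) and herm = Suc.prems(2)
  obtain e v where v: "v \<in> carrier_vec ?n" "v \<noteq> 0\<^sub>v ?n" "A *\<^sub>v v = e \<cdot>\<^sub>v v"
    using spectrum_non_empty[OF A] A unfolding spectrum_def eigenvalue_def eigenvector_def by auto
  obtain W c where W: "unitary ?n W" and W0: "col W 0 = c \<cdot>\<^sub>v v"
    using unitary_with_first_column[OF v(1,2)] by blast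
  note w = unitaryD[OF W]
  define M where "M = mat_adjoint W * (A * W)"
  have M: "M \<in> carrier_mat ?n ?n" using w A unfolding M_def by simp
  have Mh: "mat_adjoint M = M"
    using w A herm unfolding M_def
    by (simp add: mat_adjoint_mult[of _ ?n ?n _ ?n] mat_adjoint_adjoint[of _ ?n ?n]
        assoc_mult_mat[of _ ?n ?n _ ?n _ ?n])
  have "A *\<^sub>v col W 0 = e \<cdot>\<^sub>v col W 0"
    using v A by (simp add: W0 mult_mat_vec[of _ ?n ?n] smult_smult_assoc mult.commute)
  then have colAW: "col (A * W) 0 = e \<cdot>\<^sub>v col W 0"
    using A w col_mult2[OF A w(1)] by simp
  have M0: "M $$ (i, 0) = (if i = 0 then e else 0)" if "i < ?n" for i
  proof -
    have "M $$ (i, 0) = row (mat_adjoint W) i \<bullet> (e \<cdot>\<^sub>v col W 0)"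
      using that w A unfolding M_def by (subst index_mult_mat) (auto simp: colAW)
    also have "\<dots> = e * (mat_adjoint W * W) $$ (i, 0)"
      using that w(1) mat_adjoint_carrier[OF w(1)] by (subst index_mult_mat) auto
    finally show ?thesis using that by (simp add: w)
  qed
  have M0': "M $$ (0, i) = (if i = 0 then cnj e else 0)" if "i < ?n" for i
    using index_mat_adjoint[OF M, of 0 i] M0[OF that] that by (simp add: Mh)
  have e: "complex_of_real (Re e) = e"
    using M0[of 0] M0'[of 0] by (simp add: complex_eq_iff)
  then have e': "cnj e = e" by (metis complex_cnj_complex_of_real)
  define A3 where "A3 = Matrix.mat m m (\<lambda>(i, j). M $$ (Suc i, Suc j))"
  have A3: "A3 \<in> carrier_mat m m" unfolding A3_def by simp
  have "mat_adjoint A3 = A3"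
  proof (rule eq_matI)
    fix i j assume "i < dim_row A3" "j < dim_col A3"
    then have "i < m" "j < m" using A3 by auto
    then show "mat_adjoint A3 $$ (i, j) = A3 $$ (i, j)"
      using index_mat_adjoint[OF M, of "Suc i" "Suc j"]
      by (simp add: index_mat_adjoint[OF A3]) (simp add: A3_def Mh)
  qed (use A3 mat_adjoint_carrier[OF A3] in auto)
  from Suc.IH[OF A3 this] obtain U d where U: "unitary m U"
    and dec: "A3 = U * mat_diag m (\<lambda>i. complex_of_real (d i)) * mat_adjoint U" by blast
  note u = unitaryD[OF U]
  \<comment> \<open>The direct sum of \<open>1\<close> and \<open>U\<close> leaves the eigenvector
    already split off in place, so \<open>W * V\<close> diagonalizes \<open>A\<close>, with
    \<open>e\<close> put in front of the eigenvalues \<open>d\<close>.\<close>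
  define V where "V = four_block_mat (1\<^sub>m 1) (0\<^sub>m 1 m) (0\<^sub>m m 1) U"
  define d' where "d' i = (case i of 0 \<Rightarrow> Re e | Suc i \<Rightarrow> d i)" for i
  let ?D = "mat_diag ?n (\<lambda>i. complex_of_real (d' i))"
  have V: "V \<in> carrier_mat ?n ?n" using four_block_carrier_mat[OF one_carrier_mat u(1), of 1] unfolding V_def by simp
  have Vadj: "mat_adjoint V = four_block_mat (1\<^sub>m 1) (0\<^sub>m 1 m) (0\<^sub>m m 1) (mat_adjoint U)"
  proof (rule eq_matI)
    fix i j assume "i < dim_row (four_block_mat (1\<^sub>m 1) (0\<^sub>m 1 m) (0\<^sub>m m 1) (mat_adjoint U))"
      "j < dim_col (four_block_mat (1\<^sub>m 1) (0\<^sub>m 1 m) (0\<^sub>m m 1) (mat_adjoint U))"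
    then have "i < ?n" "j < ?n" using u(1) by auto
    then show "mat_adjoint V $$ (i, j)
        = four_block_mat (1\<^sub>m 1) (0\<^sub>m 1 m) (0\<^sub>m m 1) (mat_adjoint U) $$ (i, j)"
      using u(1) index_mat_adjoint[OF V, of i j] index_mat_adjoint[OF u(1), of "i - 1" "j - 1"]
      by (cases i; cases j; simp add: V_def)
  qed (use V mat_adjoint_carrier[OF V] mat_adjoint_carrier[OF u(1)] in auto)
  have D: "?D = four_block_mat (Matrix.mat 1 1 (\<lambda>_. e)) (0\<^sub>m 1 m) (0\<^sub>m m 1)
      (mat_diag m (\<lambda>i. complex_of_real (d i)))"
    by (intro eq_matI) (auto simp: mat_diag_def d'_def e split: nat.splits)
  have Me: "M = four_block_mat (Matrix.mat 1 1 (\<lambda>_. e)) (0\<^sub>m 1 m) (0\<^sub>m m 1) A3"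
    using M M0 M0' by (intro eq_matI) (auto simp: A3_def e')
  have "V * ?D = four_block_mat (Matrix.mat 1 1 (\<lambda>_. e)) (0\<^sub>m 1 m) (0\<^sub>m m 1)
      (U * mat_diag m (\<lambda>i. complex_of_real (d i)))"
    unfolding V_def D
    by (subst mult_four_block_mat[OF one_carrier_mat zero_carrier_mat zero_carrier_mat u(1)
          _ zero_carrier_mat zero_carrier_mat mat_diag_dim])
      (use u(1) in \<open>auto simp: left_add_zero_mat[OF mult_carrier_mat[OF u(1) mat_diag_dim]]
        left_mult_zero_mat[OF mat_diag_dim]\<close>)
  then have "V * ?D * mat_adjoint V = four_block_mat (Matrix.mat 1 1 (\<lambda>_. e)) (0\<^sub>m 1 m) (0\<^sub>m m 1)
      (U * mat_diag m (\<lambda>i. complex_of_real (d i)))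
      * four_block_mat (1\<^sub>m 1) (0\<^sub>m 1 m) (0\<^sub>m m 1) (mat_adjoint U)"
    by (simp only: Vadj)
  also have "\<dots> = four_block_mat (Matrix.mat 1 1 (\<lambda>_. e)) (0\<^sub>m 1 m) (0\<^sub>m m 1)
      (U * mat_diag m (\<lambda>i. complex_of_real (d i)) * mat_adjoint U)"
    using mult_carrier_mat[OF mult_carrier_mat[OF u(1) mat_diag_dim] u(2)]
    by (subst mult_four_block_mat[OF _ zero_carrier_mat zero_carrier_mat
          mult_carrier_mat[OF u(1) mat_diag_dim] one_carrier_mat zero_carrier_mat zero_carrier_mat u(2)])
      (auto simp: left_mult_zero_mat[OF u(2)] right_mult_zero_mat[OF mult_carrier_mat[OF u(1) mat_diag_dim]])
  finally have MV: "M = V * ?D * mat_adjoint V" by (simp only: Me dec)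
  have Vu: "unitary ?n V"
  proof (rule unitaryI[OF V])
    have "mat_adjoint V * V = four_block_mat (1\<^sub>m 1) (0\<^sub>m 1 m) (0\<^sub>m m 1) (1\<^sub>m m)"
      unfolding Vadj
      by (subst V_def, subst mult_four_block_mat[OF one_carrier_mat zero_carrier_mat
            zero_carrier_mat u(2) one_carrier_mat zero_carrier_mat zero_carrier_mat u(1)])
        (use u(1,2) in \<open>auto simp: u(3)\<close>)
    then show "mat_adjoint V * V = 1\<^sub>m ?n" by simp
  qed
  have "A = W * mat_adjoint W * A * (W * mat_adjoint W)" using A by (simp add: w)
  also have "\<dots> = W * M * mat_adjoint W"
    using w(1,2) A unfolding M_def by (simp add: assoc_mult_mat[of _ ?n ?n _ ?n _ ?n])
  also have "\<dots> = (W * V) * ?D * mat_adjoint (W * V)"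
    using w(1,2) V mat_adjoint_carrier[OF V] unfolding MV
    by (simp add: mult_carrier_mat[of _ ?n ?n _ ?n] mat_adjoint_mult[of _ ?n ?n _ ?n] assoc_mult_mat[of _ ?n ?n _ ?n _ ?n])
  finally show ?case using unitary_mult[OF W Vu] by blast
qed

section \<open>Entropy inequalities\<close>

text \<open>One summand of an entropy measured in bits. The factor \<open>x\<close> gives
  \<open>eta 0 = 0\<close>, the convention for vanishing probabilities.\<close>

definition eta :: "real \<Rightarrow> real" where
  "eta x = - (x * log 2 x)"

lemma eta_0 [simp]: "eta 0 = 0" and eta_1 [simp]: "eta 1 = 0"
  by (simp_all add: eta_def)

lemma eta_nonneg: "0 \<le> x \<Longrightarrow> x \<le> 1 \<Longrightarrow> 0 \<le> eta x"
  by (cases "x = 0") (auto simp: eta_def mult_le_0_iff)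

text \<open>The pointwise form of Gibbs' inequality, from \<open>ln x \<le> x - 1\<close> at
  \<open>x = q / p\<close>. The third hypothesis excludes the case where the HOL value
  \<open>ln 0 = 0\<close> could falsify the bound.\<close>

lemma mult_ln_diff_le:
  fixes p q :: real
  assumes "0 \<le> p" "0 \<le> q" "q = 0 \<Longrightarrow> p = 0"
  shows "p * (ln q - ln p) \<le> q - p"
proof (cases "p = 0")
  case False
  then have pq: "0 < p" "0 < q" using assms by (auto simp: order_less_le)
  have "p * (ln q - ln p) = p * ln (q / p)" using pq by (simp add: ln_div)
  also have "\<dots> \<le> p * (q / p - 1)"
    using pq by (intro mult_left_mono ln_le_minus_one) auto
  also have "\<dots> = q - p" using pq by (simp add: right_diff_distrib)
  finally show ?thesis .
qed (use assms in auto)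

text \<open>Compare \<open>x\<close> and \<open>y\<close> with their mean: the two instances of
  \<open>mult_ln_diff_le\<close> have right-hand sides adding up to 0. The gain is at most one bit
  per unit of weight, attained for \<open>x = y\<close>; both bits of the final bound come from
  here.\<close>

lemma eta_add_le:
  assumes "0 \<le> x" "0 \<le> y"
  shows "eta x + eta y \<le> eta (x + y) + (x + y)"
proof (cases "x + y = 0")
  case True
  then show ?thesis using assms by (simp add: add_nonneg_eq_0_iff)
next
  case False
  then have s: "0 < x + y" using assms by auto
  have *: "x * (ln ((x + y) / 2) - ln x) \<le> (x + y) / 2 - x"
    "y * (ln ((x + y) / 2) - ln y) \<le> (x + y) / 2 - y"
    using s assms by (intro mult_ln_diff_le; simp)+
  have "(x + y) * ln ((x + y) / 2) = (x + y) * ln (x + y) - (x + y) * ln 2"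
    using s by (simp add: ln_div algebra_simps)
  then have "(x + y) * ln (x + y) - (x + y) * ln 2 - x * ln x - y * ln y \<le> 0"
    using * by (simp add: algebra_simps)
  then have "((x + y) * ln (x + y) - (x + y) * ln 2 - x * ln x - y * ln y) / ln 2 \<le> 0"
    by (simp add: divide_le_0_iff)
  moreover have "eta x + eta y - (eta (x + y) + (x + y))
      = ((x + y) * ln (x + y) - (x + y) * ln 2 - x * ln x - y * ln y) / ln 2"
    by (simp add: eta_def log_def field_simps)
  ultimately show ?thesis by linarith
qed

lemma gibbs_inequality:
  assumes "finite I" "\<And>i. i \<in> I \<Longrightarrow> 0 \<le> p i" "\<And>i. i \<in> I \<Longrightarrow> 0 \<le> q i"
    "\<And>i. i \<in> I \<Longrightarrow> q i = 0 \<Longrightarrow> p i = 0" "sum q I \<le> sum p I"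
  shows "(\<Sum>i\<in>I. p i * log 2 (q i)) \<le> (\<Sum>i\<in>I. p i * log 2 (p i))"
proof -
  have "(\<Sum>i\<in>I. p i * (ln (q i) - ln (p i))) \<le> (\<Sum>i\<in>I. q i - p i)"
    using assms by (intro sum_mono mult_ln_diff_le) auto
  also have "\<dots> \<le> 0" using assms by (simp add: sum_subtractf)
  finally have "(\<Sum>i\<in>I. p i * ln (q i)) / ln 2 \<le> (\<Sum>i\<in>I. p i * ln (p i)) / ln 2"
    by (simp add: right_diff_distrib sum_subtractf divide_right_mono)
  then show ?thesis by (simp add: log_def sum_divide_distrib)
qed

text \<open>Read \<open>a\<close> as joint weights with row sums \<open>r\<close> and column sums
  \<open>q\<close>. Sum the pointwise bound \<open>le\<close> over \<open>k\<close>: for fixed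
  \<open>j\<close> the hypothesis \<open>bessel\<close> leaves at most \<open>q j - q j = 0\<close>.
  Hence the row sums carry no more entropy than the column sums, whatever the total weight
  is.\<close>

lemma sum_eta_le_of_substochastic:
  fixes a :: "'k \<Rightarrow> 'j \<Rightarrow> real"
  assumes fin: "finite K" "finite J"
    and a: "\<And>k j. k \<in> K \<Longrightarrow> j \<in> J \<Longrightarrow> 0 \<le> a k j"
    and bessel: "\<And>j. j \<in> J \<Longrightarrow> (\<Sum>k\<in>K. a k j / (\<Sum>i\<in>J. a k i)) \<le> 1"
  shows "(\<Sum>k\<in>K. eta (\<Sum>j\<in>J. a k j)) \<le> (\<Sum>j\<in>J. eta (\<Sum>k\<in>K. a k j))"
proof -
  define r where "r k = (\<Sum>j\<in>J. a k j)" for k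
  define q where "q j = (\<Sum>k\<in>K. a k j)" for j
  have le: "a k j * (ln (q j) - ln (r k)) \<le> q j * (a k j / r k) - a k j"
    if kj: "k \<in> K" "j \<in> J" for k j
  proof (cases "a k j = 0")
    case False
    \<comment> \<open>A nonzero entry forces its row sum and its column sum to be positive, so
      vanishing sums occur only in the trivial case.\<close>
    then have pos: "0 < a k j" using a kj by (simp add: order_less_le)
    have "a k j \<le> r k" "a k j \<le> q j"
      unfolding r_def q_def using a kj fin by (auto intro!: member_le_sum)
    with pos have p: "0 < r k" "0 < q j" by auto
    have "ln (q j) - ln (r k) \<le> q j / r k - 1"
      using ln_le_minus_one[of "q j / r k"] p by (simp add: ln_div)
    then have "a k j * (ln (q j) - ln (r k)) \<le> a k j * (q j / r k - 1)"
      using pos by (intro mult_left_mono) auto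
    then show ?thesis by (simp add: algebra_simps)
  qed simp
  have q0: "0 \<le> q j" if "j \<in> J" for j unfolding q_def using a that by (intro sum_nonneg) auto
  have "(\<Sum>j\<in>J. q j * ln (q j)) - (\<Sum>k\<in>K. r k * ln (r k))
      = (\<Sum>j\<in>J. \<Sum>k\<in>K. a k j * ln (q j)) - (\<Sum>k\<in>K. \<Sum>j\<in>J. a k j * ln (r k))"
    by (simp add: q_def r_def sum_distrib_right)
  also have "(\<Sum>k\<in>K. \<Sum>j\<in>J. a k j * ln (r k)) = (\<Sum>j\<in>J. \<Sum>k\<in>K. a k j * ln (r k))"
    by (rule sum.swap)
  also have "(\<Sum>j\<in>J. \<Sum>k\<in>K. a k j * ln (q j)) - (\<Sum>j\<in>J. \<Sum>k\<in>K. a k j * ln (r k))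
      = (\<Sum>j\<in>J. \<Sum>k\<in>K. a k j * (ln (q j) - ln (r k)))"
    by (simp add: right_diff_distrib sum_subtractf)
  also have "\<dots> \<le> (\<Sum>j\<in>J. \<Sum>k\<in>K. q j * (a k j / r k) - a k j)"
    using le by (intro sum_mono) auto
  also have "\<dots> = (\<Sum>j\<in>J. q j * (\<Sum>k\<in>K. a k j / r k) - q j)"
    by (simp add: sum_subtractf sum_distrib_left q_def)
  also have "\<dots> \<le> (\<Sum>j\<in>J. 0)"
    using bessel q0 unfolding r_def by (intro sum_mono) (simp add: mult_left_le)
  finally have "(\<Sum>j\<in>J. q j * ln (q j)) / ln 2 \<le> (\<Sum>k\<in>K. r k * ln (r k)) / ln 2"
    by (simp add: divide_right_mono)
  then show ?thesis
    by (simp add: eta_def log_def sum_negf sum_divide_distrib r_def q_def)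
qed

section \<open>Bessel's inequality for orthogonal rows\<close>

lemma mult_cnj_cmod: "z * cnj z = complex_of_real ((cmod z)\<^sup>2)"
  by (simp only: complex_norm_square[symmetric] of_real_power)

lemma cnj_mult_cmod: "cnj z * z = complex_of_real ((cmod z)\<^sup>2)"
  by (simp only: complex_norm_square[symmetric] of_real_power mult.commute[of "cnj z"])

text \<open>Rows with \<open>c k = 0\<close> contribute \<open>0 / 0 = 0\<close>.\<close>

lemma bessel_orthogonal_rows:
  fixes c :: "'k \<Rightarrow> 'j \<Rightarrow> complex"
  assumes fin: "finite K" "finite J" and j: "j \<in> J"
    and orth: "\<And>k l. k \<in> K \<Longrightarrow> l \<in> K \<Longrightarrow> k \<noteq> l \<Longrightarrow> (\<Sum>i\<in>J. c k i * cnj (c l i)) = 0"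
  shows "(\<Sum>k\<in>K. (cmod (c k j))\<^sup>2 / (\<Sum>i\<in>J. (cmod (c k i))\<^sup>2)) \<le> 1"
proof -
  define r where "r k = (\<Sum>i\<in>J. (cmod (c k i))\<^sup>2)" for k
  define s where "s = (\<Sum>k\<in>K. (cmod (c k j))\<^sup>2 / r k)"
  \<comment> \<open>\<open>y\<close> is the orthogonal projection of the \<open>j\<close>-th unit
    vector onto the span of the rows, so its squared norm equals its own \<open>j\<close>-th
    coordinate \<open>s\<close>. Bounding the square of that coordinate by the squared norm gives
    \<open>s\<^sup>2 \<le> s\<close>, hence \<open>s \<le> 1\<close>.\<close>
  define y where "y i = (\<Sum>k\<in>K. cnj (c k j) * c k i / complex_of_real (r k))" for i
  have r: "(\<Sum>i\<in>J. c k i * cnj (c k i)) = complex_of_real (r k)" for k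
    by (simp add: r_def mult_cnj_cmod)
  have yj: "y j = complex_of_real s"
    by (simp add: y_def s_def mult_cnj_cmod cnj_mult_cmod)
  have "complex_of_real (\<Sum>i\<in>J. (cmod (y i))\<^sup>2) = (\<Sum>i\<in>J. y i * cnj (y i))"
    by (simp add: mult_cnj_cmod)
  also have "\<dots> = (\<Sum>i\<in>J. \<Sum>k\<in>K. \<Sum>l\<in>K. cnj (c k j) * c l j / (r k * r l) * (c k i * cnj (c l i)))"
    by (simp add: y_def sum_product field_simps)
  also have "\<dots> = (\<Sum>k\<in>K. \<Sum>l\<in>K. \<Sum>i\<in>J. cnj (c k j) * c l j / (r k * r l) * (c k i * cnj (c l i)))"
    by (subst sum.swap, rule sum.cong[OF refl], subst sum.swap) simp
  also have "\<dots> = (\<Sum>k\<in>K. \<Sum>l\<in>K. cnj (c k j) * c l j / (r k * r l) * (\<Sum>i\<in>J. c k i * cnj (c l i)))"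
    by (simp add: sum_distrib_left)
  also have "\<dots> = (\<Sum>k\<in>K. \<Sum>l\<in>K. if l = k then complex_of_real ((cmod (c k j))\<^sup>2 / r k) else 0)"
  proof (intro sum.cong refl)
    fix k l assume "k \<in> K" "l \<in> K"
    then show "cnj (c k j) * c l j / (r k * r l) * (\<Sum>i\<in>J. c k i * cnj (c l i))
        = (if l = k then complex_of_real ((cmod (c k j))\<^sup>2 / r k) else 0)"
      using orth[of k l] r[of k] by (cases "r k = 0") (auto simp: mult_cnj_cmod cnj_mult_cmod)
  qed
  also have "\<dots> = complex_of_real s" using fin by (simp add: s_def)
  finally have ys: "(\<Sum>i\<in>J. (cmod (y i))\<^sup>2) = s" using of_real_eq_iff by blast
  have "s\<^sup>2 = (cmod (y j))\<^sup>2" by (simp add: yj)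
  also have "\<dots> \<le> (\<Sum>i\<in>J. (cmod (y i))\<^sup>2)" using fin j by (intro member_le_sum) auto
  finally have "s * s \<le> 1 * s" unfolding ys by (simp add: power2_eq_square)
  then have "s \<le> 1" using mult_right_le_imp_le[of s s 1] by (cases "0 < s") auto
  then show ?thesis by (simp add: s_def r_def)
qed

section \<open>Functional calculus\<close>

lemma index_unitary_conj_diag:
  assumes "U \<in> carrier_mat n n" "i < n" "j < n"
  shows "(U * mat_diag n f * mat_adjoint U) $$ (i, j) = (\<Sum>k<n. f k * U $$ (i, k) * cnj (U $$ (j, k)))"
  using assms mat_adjoint_carrier[OF assms(1)]
  by (auto simp: mat_diag_mult_right[OF assms(1)] scalar_prod_def index_mat_adjoint[OF assms(1)]
      atLeast0LessThan mult.commute intro!: sum.cong)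

lemma unitary_conj_diag_carrier:
  "U \<in> carrier_mat n n \<Longrightarrow> U * mat_diag n f * mat_adjoint U \<in> carrier_mat n n"
  using mat_adjoint_carrier[of U n n] mat_diag_dim by (intro mult_carrier_mat)

lemma unitary_columns:
  assumes "unitary n U" "k < n" "l < n"
  shows "(\<Sum>i<n. cnj (U $$ (i, k)) * U $$ (i, l)) = (if k = l then 1 else 0)"
proof -
  note u = unitaryD[OF assms(1)]
  have "(mat_adjoint U * U) $$ (k, l) = (\<Sum>i<n. cnj (U $$ (i, k)) * U $$ (i, l))"
    using u(1,2) assms(2,3)
    by (auto simp: scalar_prod_def index_mat_adjoint[OF u(1)] atLeast0LessThan intro!: sum.cong)
  then show ?thesis using assms by (simp add: u)
qed

lemma unitary_rows:
  assumes "unitary n U" "k < n" "l < n"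
  shows "(\<Sum>i<n. U $$ (k, i) * cnj (U $$ (l, i))) = (if k = l then 1 else 0)"
proof -
  note u = unitaryD[OF assms(1)]
  have "(U * mat_adjoint U) $$ (k, l) = (\<Sum>i<n. U $$ (k, i) * cnj (U $$ (l, i)))"
    using u(1,2) assms(2,3)
    by (auto simp: scalar_prod_def index_mat_adjoint[OF u(1)] atLeast0LessThan intro!: sum.cong)
  then show ?thesis using assms by (simp add: u)
qed

lemma unitary_column_norm:
  assumes "unitary n U" "k < n"
  shows "(\<Sum>i<n. (cmod (U $$ (i, k)))\<^sup>2) = 1"
proof -
  have "complex_of_real (\<Sum>i<n. (cmod (U $$ (i, k)))\<^sup>2) = 1"
    using unitary_columns[OF assms assms(2)] by (simp add: mult_cnj_cmod cnj_mult_cmod)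
  then show ?thesis using of_real_eq_1_iff by blast
qed

text \<open>The definite description has a value because the result does not depend on the
  diagonalization. For a second one, with unitary \<open>V\<close> and eigenvalues \<open>e\<close>,
  the matrix \<open>W\<close> intertwines the two diagonal matrices; entrywise
  \<open>W $$ (i, j)\<close> vanishes unless \<open>d j = e i\<close>, so \<open>W\<close> also
  intertwines their images under \<open>f\<close>.\<close>

lemma spectral_fun_unitary_conj_diag:
  assumes U: "unitary n U"
    and A: "A = U * mat_diag n (\<lambda>i. complex_of_real (d i)) * mat_adjoint U"
  shows "spectral_fun f A = U * mat_diag n (\<lambda>i. complex_of_real (f (d i))) * mat_adjoint U"
proof -
  note u = unitaryD[OF U]
  have n: "dim_row A = n" using u(1) unfolding A by simp
  have unique: "V * mat_diag n (\<lambda>i. complex_of_real (f (e i))) * mat_adjoint V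
      = U * mat_diag n (\<lambda>i. complex_of_real (f (d i))) * mat_adjoint U"
    if V: "unitary n V" and AV: "A = V * mat_diag n (\<lambda>i. complex_of_real (e i)) * mat_adjoint V" for V e
  proof -
    note v = unitaryD[OF V]
    let ?D = "mat_diag n (\<lambda>i. complex_of_real (d i))" and ?E = "mat_diag n (\<lambda>i. complex_of_real (e i))"
    let ?fD = "mat_diag n (\<lambda>i. complex_of_real (f (d i)))"
    let ?fE = "mat_diag n (\<lambda>i. complex_of_real (f (e i)))"
    note c = u(1,2) v(1,2) mat_diag_dim
    note assoc = assoc_mult_mat[of _ n n _ n _ n] mult_carrier_mat[of _ n n _ n]
    have cancel: "mat_adjoint U * (U * X) = X" "mat_adjoint V * (V * X) = X"
      "U * (mat_adjoint U * X) = X" "V * (mat_adjoint V * X) = X" if "X \<in> carrier_mat n n" for X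
      using that c by (simp_all add: u v flip: assoc(1))
    define W where "W = mat_adjoint V * U"
    have W: "W \<in> carrier_mat n n" unfolding W_def by (rule mult_carrier_mat[OF c(4,1)])
    have "mat_adjoint V * (A * U) = W * ?D"
      unfolding A W_def using c by (simp add: assoc u right_mult_one_mat[OF mat_diag_dim])
    moreover have "mat_adjoint V * (A * U) = ?E * W"
      unfolding AV W_def using c by (simp add: assoc cancel)
    ultimately have WDE: "W * ?D = ?E * W" by simp
    have "W * ?fD = ?fE * W"
    proof (rule eq_matI)
      fix i j assume "i < dim_row (?fE * W)" "j < dim_col (?fE * W)"
      then have ij: "i < n" "j < n" using W by (auto simp: mat_diag_def)
      have "W $$ (i, j) * complex_of_real (d j) = complex_of_real (e i) * W $$ (i, j)"
        using arg_cong[OF WDE, of "\<lambda>X. X $$ (i, j)"] ij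
        by (simp add: mat_diag_mult_left[OF W] mat_diag_mult_right[OF W])
      then have "W $$ (i, j) = 0 \<or> d j = e i" by (simp add: mult.commute)
      then show "(W * ?fD) $$ (i, j) = (?fE * W) $$ (i, j)"
        using ij by (auto simp: mat_diag_mult_left[OF W] mat_diag_mult_right[OF W])
    qed (use W in \<open>auto simp: mat_diag_def\<close>)
    then have "V * (W * ?fD) * mat_adjoint U = V * (?fE * W) * mat_adjoint U" by simp
    moreover have "V * (W * ?fD) * mat_adjoint U = U * ?fD * mat_adjoint U"
      unfolding W_def using c by (simp add: assoc cancel)
    moreover have "V * (?fE * W) * mat_adjoint U = V * ?fE * mat_adjoint V"
      unfolding W_def using c by (simp add: assoc cancel u)
    ultimately show ?thesis by simp
  qed
  show ?thesis
    unfolding spectral_fun_def n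
    by (rule the_equality) (use U A unique in blast)+
qed

section \<open>Ensembles and the relative entropy of coherence\<close>

text \<open>The vectors \<open>w m\<close> need be neither normalised nor orthogonal. The weights
  \<open>c m\<close> may have either sign, so that the spectral form of
  \<open>\<rho> * mat_log2 \<rho>\<close> is covered as well.\<close>

definition ensemble ::
  "nat \<Rightarrow> 'j set \<Rightarrow> ('j \<Rightarrow> real) \<Rightarrow> ('j \<Rightarrow> nat \<Rightarrow> complex) \<Rightarrow> complex mat \<Rightarrow> bool" where
  "ensemble n J c w \<rho> \<longleftrightarrow> \<rho> \<in> carrier_mat n n \<and>
     (\<forall>i<n. \<forall>j<n. \<rho> $$ (i, j) = (\<Sum>m\<in>J. complex_of_real (c m) * w m i * cnj (w m j)))"

lemma ensembleD:
  assumes "ensemble n J c w \<rho>"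
  shows "\<rho> \<in> carrier_mat n n"
    "i < n \<Longrightarrow> j < n \<Longrightarrow> \<rho> $$ (i, j) = (\<Sum>m\<in>J. complex_of_real (c m) * w m i * cnj (w m j))"
  using assms unfolding ensemble_def by auto

lemma ensemble_diag:
  assumes "ensemble n J c w \<rho>" "i < n"
  shows "\<rho> $$ (i, i) = complex_of_real (\<Sum>m\<in>J. c m * (cmod (w m i))\<^sup>2)"
  using ensembleD(2)[OF assms(1,2,2)] by (simp add: mult.assoc mult_cnj_cmod)

lemma ensemble_hermitian:
  assumes "ensemble n J c w \<rho>"
  shows "mat_adjoint \<rho> = \<rho>"
proof (rule eq_matI)
  note r = ensembleD[OF assms]
  fix i j assume "i < dim_row \<rho>" "j < dim_col \<rho>"
  then show "mat_adjoint \<rho> $$ (i, j) = \<rho> $$ (i, j)"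
    using r(1) by (auto simp: index_mat_adjoint[OF r(1)] r(2) intro!: sum.cong)
qed (use ensembleD(1)[OF assms] in auto)

text \<open>Serves twice: nonnegative weights make the form nonnegative, and evaluated on an
  eigenvector it isolates the corresponding eigenvalue.\<close>

lemma ensemble_quadratic_form:
  assumes "ensemble n J c w \<rho>" and v: "v \<in> carrier_vec n"
  shows "(\<rho> *\<^sub>v v) \<bullet>c v
    = complex_of_real (\<Sum>m\<in>J. c m * (cmod (\<Sum>j<n. cnj (w m j) * v $ j))\<^sup>2)"
proof -
  note r = ensembleD[OF assms(1)]
  have "(\<rho> *\<^sub>v v) \<bullet>c v = (\<Sum>i<n. (\<Sum>j<n. \<rho> $$ (i, j) * v $ j) * cnj (v $ i))"
    using r(1) v by (auto simp: scalar_prod_def atLeast0LessThan intro!: sum.cong)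
  also have "\<dots> = (\<Sum>i<n. \<Sum>j<n. \<Sum>m\<in>J. complex_of_real (c m)
      * ((cnj (w m j) * v $ j) * cnj (cnj (w m i) * v $ i)))"
    by (auto simp: r(2) sum_distrib_right sum_distrib_left intro!: sum.cong)
  also have "\<dots> = (\<Sum>m\<in>J. \<Sum>i<n. \<Sum>j<n. complex_of_real (c m)
      * ((cnj (w m j) * v $ j) * cnj (cnj (w m i) * v $ i)))"
    by (subst (2) sum.swap, subst sum.swap) simp
  also have "\<dots> = (\<Sum>m\<in>J. complex_of_real (c m)
      * ((\<Sum>j<n. cnj (w m j) * v $ j) * cnj (\<Sum>j<n. cnj (w m j) * v $ j)))"
  proof (intro sum.cong refl)
    fix m
    show "(\<Sum>i<n. \<Sum>j<n. complex_of_real (c m) * ((cnj (w m j) * v $ j) * cnj (cnj (w m i) * v $ i)))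
      = complex_of_real (c m)
        * ((\<Sum>j<n. cnj (w m j) * v $ j) * cnj (\<Sum>j<n. cnj (w m j) * v $ j))"
      unfolding cnj_sum sum_product unfolding sum_distrib_left by (rule sum.swap)
  qed
  finally show ?thesis by (simp only: mult_cnj_cmod of_real_sum of_real_mult)
qed

lemma ensemble_trace:
  assumes "ensemble n J c w \<rho>"
  shows "mat_trace \<rho> = complex_of_real (\<Sum>m\<in>J. c m * (\<Sum>i<n. (cmod (w m i))\<^sup>2))"
proof -
  have "mat_trace \<rho> = (\<Sum>i<n. complex_of_real (\<Sum>m\<in>J. c m * (cmod (w m i))\<^sup>2))"
    using ensembleD(1)[OF assms] by (auto simp: mat_trace_def ensemble_diag[OF assms])
  also have "\<dots> = complex_of_real (\<Sum>i<n. \<Sum>m\<in>J. c m * (cmod (w m i))\<^sup>2)" by simp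
  also have "(\<Sum>i<n. \<Sum>m\<in>J. c m * (cmod (w m i))\<^sup>2) = (\<Sum>m\<in>J. c m * (\<Sum>i<n. (cmod (w m i))\<^sup>2))"
    by (subst sum.swap) (simp add: sum_distrib_left)
  finally show ?thesis .
qed

lemma ensemble_in_states:
  assumes e: "ensemble n J c w \<rho>" and c: "\<And>m. m \<in> J \<Longrightarrow> 0 \<le> c m"
    and norm: "(\<Sum>m\<in>J. c m * (\<Sum>i<n. (cmod (w m i))\<^sup>2)) = 1"
  shows "\<rho> \<in> states n"
proof -
  have "psd n \<rho>"
    unfolding psd_def using ensembleD(1)[OF e] ensemble_hermitian[OF e] c
    by (auto simp: ensemble_quadratic_form[OF e] intro!: sum_nonneg simp del: of_real_sum)
  then show ?thesis using ensemble_trace[OF e] norm by (simp add: states_def)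
qed

lemma unitary_conj_diag_ensemble:
  assumes "unitary n U" "\<rho> = U * mat_diag n (\<lambda>i. complex_of_real (d i)) * mat_adjoint U"
  shows "ensemble n {..<n} d (\<lambda>k i. U $$ (i, k)) \<rho>"
  using unitaryD(1)[OF assms(1)]
  by (auto simp: ensemble_def assms(2) index_unitary_conj_diag unitary_conj_diag_carrier
      simp del: index_mult_mat)

lemma state_spectral_decomposition:
  assumes "\<rho> \<in> states n"
  obtains U d where "unitary n U" "\<rho> = U * mat_diag n (\<lambda>i. complex_of_real (d i)) * mat_adjoint U"
    "\<And>k. k < n \<Longrightarrow> 0 \<le> d k" "(\<Sum>k<n. d k) = 1"
proof -
  have psd: "psd n \<rho>" and tr: "mat_trace \<rho> = 1" using assms unfolding states_def by auto
  then obtain U d where U: "unitary n U"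
    and dec: "\<rho> = U * mat_diag n (\<lambda>i. complex_of_real (d i)) * mat_adjoint U"
    using hermitian_diagonalizable unfolding psd_def by blast
  note u = unitaryD[OF U] and e = unitary_conj_diag_ensemble[OF U dec]
  have "0 \<le> d k" if k: "k < n" for k
  proof -
    \<comment> \<open>The \<open>k\<close>-th eigenvector is the test vector: by orthonormality of
      the columns only the summand \<open>m = k\<close> of the quadratic form survives, with value
      \<open>d k\<close>.\<close>
    have v: "col U k \<in> carrier_vec n" using u(1) k by auto
    have "(\<Sum>j<n. cnj (U $$ (j, m)) * col U k $ j) = (if m = k then 1 else 0)" if "m < n" for m
      using unitary_columns[OF U that k] u(1) k by (auto intro!: sum.cong)
    then have "(\<Sum>m<n. d m * (cmod (\<Sum>j<n. cnj (U $$ (j, m)) * col U k $ j))\<^sup>2)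
        = (\<Sum>m<n. if m = k then d m else 0)" by (intro sum.cong) auto
    also have "\<dots> = d k" using k by simp
    finally have "Re ((\<rho> *\<^sub>v col U k) \<bullet>c col U k) = d k"
      by (simp only: ensemble_quadratic_form[OF e v] Re_complex_of_real)
    then show ?thesis using psd v unfolding psd_def by metis
  qed
  moreover have "(\<Sum>k<n. d k) = 1"
  proof -
    have "complex_of_real (\<Sum>k<n. d k) = 1"
      using ensemble_trace[OF e] unitary_column_norm[OF U] tr by simp
    then show ?thesis using of_real_eq_1_iff by blast
  qed
  ultimately show thesis using that U dec by blast
qed

section \<open>Von Neumann entropy and the diagonal of a state\<close>

definition vN_entropy :: "complex mat \<Rightarrow> real" where
  "vN_entropy \<rho> = - Re (mat_trace (\<rho> * mat_log2 \<rho>))"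

lemma vN_entropy_unitary_conj_diag:
  assumes U: "unitary n U" and dec: "\<rho> = U * mat_diag n (\<lambda>i. complex_of_real (d i)) * mat_adjoint U"
  shows "vN_entropy \<rho> = (\<Sum>k<n. eta (d k))"
proof -
  note u = unitaryD[OF U]
  let ?l = "\<lambda>x::real. if x = 0 then 0 else log 2 x"
  let ?L = "mat_diag n (\<lambda>i. complex_of_real (?l (d i)))"
  let ?D = "mat_diag n (\<lambda>i. complex_of_real (d i))"
  have L: "mat_log2 \<rho> = U * ?L * mat_adjoint U"
    unfolding mat_log2_def using spectral_fun_unitary_conj_diag[OF U dec] .
  note assoc = assoc_mult_mat[of _ n n _ n _ n] mult_carrier_mat[of _ n n _ n]
  have "mat_adjoint U * (U * X) = X" if "X \<in> carrier_mat n n" for X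
    using that u by (simp flip: assoc(1))
  then have "\<rho> * mat_log2 \<rho> = U * (?D * (?L * mat_adjoint U))"
    unfolding dec L[unfolded dec] using u(1,2) mat_diag_dim by (simp add: assoc)
  also have "\<dots> = U * (?D * ?L) * mat_adjoint U"
    using u(1,2) mat_diag_dim by (simp add: assoc del: mat_diag_diag)
  also have "?D * ?L = mat_diag n (\<lambda>i. complex_of_real (d i * ?l (d i)))"
    by simp
  \<comment> \<open>The product has the same eigenbasis as \<open>\<rho>\<close>, so the trace
    formula for ensembles, applied with these signed weights, reads off the entropy.\<close>
  finally have e: "ensemble n {..<n} (\<lambda>i. d i * ?l (d i)) (\<lambda>k i. U $$ (i, k)) (\<rho> * mat_log2 \<rho>)"
    by (rule unitary_conj_diag_ensemble[OF U])
  show ?thesis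
    unfolding vN_entropy_def ensemble_trace[OF e] using unitary_column_norm[OF U]
    by (auto simp: eta_def sum_negf[symmetric] intro!: sum.cong)
qed

lemma real_diagonal_mat:
  assumes "\<sigma> \<in> carrier_mat n n" "diagonal_mat \<sigma>" "\<And>i. i < n \<Longrightarrow> \<sigma> $$ (i, i) \<in> \<real>"
  shows "\<sigma> = mat_diag n (\<lambda>i. complex_of_real (Re (\<sigma> $$ (i, i))))"
  using assms by (intro eq_matI) (auto simp: mat_diag_def diagonal_mat_def of_real_Re)

lemma mat_diag_unitary_conj:
  fixes f :: "nat \<Rightarrow> complex"
  shows "mat_diag n f = 1\<^sub>m n * mat_diag n f * mat_adjoint (1\<^sub>m n)"
proof -
  have "mat_adjoint (1\<^sub>m n :: complex mat) = 1\<^sub>m n"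
    using unitaryD(3)[OF unitary_one, of n] unitaryD(2)[OF unitary_one, of n] by simp
  then show ?thesis by (simp add: left_mult_one_mat[OF mat_diag_dim] right_mult_one_mat[OF mat_diag_dim])
qed

lemma vN_entropy_mat_diag:
  "vN_entropy (mat_diag n (\<lambda>i. complex_of_real (p i))) = (\<Sum>i<n. eta (p i))"
  by (rule vN_entropy_unitary_conj_diag[OF unitary_one mat_diag_unitary_conj])

lemma mat_log2_mat_diag:
  "mat_log2 (mat_diag n (\<lambda>i. complex_of_real (p i)))
    = mat_diag n (\<lambda>i. complex_of_real (log 2 (p i)))"
proof -
  \<comment> \<open>The case split of \<open>mat_log2\<close> on the kernel disappears because
    \<open>log 2 0 = 0\<close> in HOL.\<close>
  have "(if p i = 0 then 0 else log 2 (p i)) = log 2 (p i)" for i by (simp add: log_def)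
  then show ?thesis
    unfolding mat_log2_def
    using spectral_fun_unitary_conj_diag[OF unitary_one mat_diag_unitary_conj,
        where f = "\<lambda>x. if x = 0 then 0 else log 2 x" and d = p]
    by (simp add: mat_diag_unitary_conj[symmetric])
qed

lemma mat_trace_mult_mat_diag:
  assumes "\<rho> \<in> carrier_mat n n"
  shows "mat_trace (\<rho> * mat_diag n f) = (\<Sum>i<n. \<rho> $$ (i, i) * f i)"
  using assms by (simp add: mat_trace_def mat_diag_mult_right)

lemma state_diag:
  assumes "\<rho> \<in> states n"
  shows "\<rho> \<in> carrier_mat n n"
    "i < n \<Longrightarrow> \<rho> $$ (i, i) \<in> \<real>"
    "i < n \<Longrightarrow> 0 \<le> Re (\<rho> $$ (i, i))"
    "i < n \<Longrightarrow> j < n \<Longrightarrow> Re (\<rho> $$ (i, i)) = 0 \<Longrightarrow> \<rho> $$ (j, i) = 0"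
    "(\<Sum>i<n. Re (\<rho> $$ (i, i))) = 1"
proof -
  obtain U d where U: "unitary n U"
    and dec: "\<rho> = U * mat_diag n (\<lambda>i. complex_of_real (d i)) * mat_adjoint U"
    and d: "\<And>k. k < n \<Longrightarrow> 0 \<le> d k" using state_spectral_decomposition[OF assms] by metis
  note e = unitary_conj_diag_ensemble[OF U dec]
  show c: "\<rho> \<in> carrier_mat n n" using ensembleD(1)[OF e] .
  show "i < n \<Longrightarrow> \<rho> $$ (i, i) \<in> \<real>"
    by (simp only: ensemble_diag[OF e] Reals_of_real)
  show "i < n \<Longrightarrow> 0 \<le> Re (\<rho> $$ (i, i))"
    using d by (auto simp: ensemble_diag[OF e] intro!: sum_nonneg simp del: of_real_sum)
  show "\<rho> $$ (j, i) = 0" if "i < n" "j < n" "Re (\<rho> $$ (i, i)) = 0"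
  proof -
    \<comment> \<open>A zero diagonal entry is a vanishing sum of nonnegative terms, so every
      eigenvector with nonzero eigenvalue has coordinate \<open>i\<close> equal to 0. The whole
      column then vanishes, which puts the kernel of the dephased state inside that of
      \<open>\<rho>\<close>.\<close>
    have "(\<Sum>m<n. d m * (cmod (U $$ (i, m)))\<^sup>2) = 0"
      using that(3) by (simp only: ensemble_diag[OF e that(1)] Re_complex_of_real)
    then have "d m * (cmod (U $$ (i, m)))\<^sup>2 = 0" if "m < n" for m
      using d that by (subst (asm) sum_nonneg_eq_0_iff) auto
    then have "d m = 0 \<or> U $$ (i, m) = 0" if "m < n" for m
      using that by simp
    then have "complex_of_real (d m) * U $$ (j, m) * cnj (U $$ (i, m)) = 0" if "m < n" for m
      using that by auto
    then show ?thesis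
      unfolding ensembleD(2)[OF e that(2,1)] by (intro sum.neutral ballI) (simp only: lessThan_iff)
  qed
  have "Re (mat_trace \<rho>) = 1" using assms by (simp add: states_def)
  then show "(\<Sum>i<n. Re (\<rho> $$ (i, i))) = 1" using c by (simp add: mat_trace_def)
qed

section \<open>Coherence as a difference of entropies\<close>

text \<open>The finite branch of \<open>rel_entropy\<close> applies: a vector killed by the diagonal
  matrix is supported where \<open>p\<close> vanishes, and there the columns of
  \<open>\<rho>\<close> vanish by \<open>state_diag\<close>. The trace against a diagonal logarithm
  sees only the diagonal of \<open>\<rho>\<close>.\<close>

lemma rel_entropy_mat_diag:
  assumes \<rho>: "\<rho> \<in> states n"
    and p: "\<And>i. i < n \<Longrightarrow> p i = 0 \<Longrightarrow> Re (\<rho> $$ (i, i)) = 0"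
  shows "rel_entropy \<rho> (mat_diag n (\<lambda>i. complex_of_real (p i)))
    = ereal (- vN_entropy \<rho> - (\<Sum>i<n. Re (\<rho> $$ (i, i)) * log 2 (p i)))"
proof -
  note r = state_diag[OF \<rho>]
  have dim: "dim_row \<rho> = n" using r(1) by auto
  have "\<rho> *\<^sub>v v = 0\<^sub>v n" if v: "v \<in> carrier_vec n"
    and z: "mat_diag n (\<lambda>i. complex_of_real (p i)) *\<^sub>v v = 0\<^sub>v n" for v
  proof (rule eq_vecI)
    fix j assume "j < dim_vec (0\<^sub>v n :: complex vec)"
    then have j: "j < n" by simp
    have "\<rho> $$ (j, i) * v $ i = 0" if i: "i < n" for i
    proof -
      have "(mat_diag n (\<lambda>i. complex_of_real (p i)) *\<^sub>v v) $ i = complex_of_real (p i) * v $ i"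
        using v i by (simp add: mat_diag_def scalar_prod_def if_distrib[of "\<lambda>x. x * _"] cong: if_cong)
      then have "p i = 0 \<or> v $ i = 0" using z i by simp
      then show ?thesis using p[OF i] r(4)[OF i j] by auto
    qed
    then show "(\<rho> *\<^sub>v v) $ j = 0\<^sub>v n $ j"
      using r(1) v j by (auto simp: scalar_prod_def intro!: sum.neutral)
  qed (use r(1) in auto)
  then have "rel_entropy \<rho> (mat_diag n (\<lambda>i. complex_of_real (p i)))
      = ereal (Re (mat_trace (\<rho> * mat_log2 \<rho>)
          - mat_trace (\<rho> * mat_log2 (mat_diag n (\<lambda>i. complex_of_real (p i))))))"
    unfolding rel_entropy_def dim by auto
  then show ?thesis
    by (simp add: vN_entropy_def mat_log2_mat_diag mat_trace_mult_mat_diag[OF r(1)])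
qed

lemma dephased_in_incoherent_states:
  assumes "\<rho> \<in> states n"
  shows "mat_diag n (\<lambda>i. complex_of_real (Re (\<rho> $$ (i, i)))) \<in> incoherent_states n"
proof -
  note r = state_diag[OF assms]
  let ?p = "\<lambda>i. Re (\<rho> $$ (i, i))"
  have "ensemble n {..<n} ?p (\<lambda>k i. (1\<^sub>m n :: complex mat) $$ (i, k))
      (mat_diag n (\<lambda>i. complex_of_real (?p i)))"
    by (rule unitary_conj_diag_ensemble[OF unitary_one mat_diag_unitary_conj])
  then have "mat_diag n (\<lambda>i. complex_of_real (?p i)) \<in> states n"
    by (rule ensemble_in_states) (use r unitary_column_norm[OF unitary_one] in auto)
  then show ?thesis by (auto simp: incoherent_states_def diagonal_mat_def mat_diag_def)
qed

text \<open>Against a diagonal state only the cross term of the diagonal of \<open>\<rho>\<close>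
  with \<open>log 2 (p i)\<close> varies, and Gibbs' inequality maximises it when \<open>p\<close>
  is that diagonal. So the infimum is attained at the dephased state.\<close>

lemma rel_ent_coherence_eq:
  assumes \<rho>: "\<rho> \<in> states n"
  shows "rel_ent_coherence \<rho> = ereal ((\<Sum>i<n. eta (Re (\<rho> $$ (i, i)))) - vN_entropy \<rho>)"
proof -
  note r = state_diag[OF \<rho>]
  have dim: "dim_row \<rho> = n" using r(1) by auto
  let ?c = "ereal ((\<Sum>i<n. eta (Re (\<rho> $$ (i, i)))) - vN_entropy \<rho>)"
  have lower: "?c \<le> rel_entropy \<rho> \<sigma>" if "\<sigma> \<in> incoherent_states n" for \<sigma>
  proof -
    have \<sigma>: "\<sigma> \<in> states n" "diagonal_mat \<sigma>" using that by (auto simp: incoherent_states_def)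
    note s = state_diag[OF \<sigma>(1)]
    define p where "p i = Re (\<sigma> $$ (i, i))" for i
    have sp: "\<sigma> = mat_diag n (\<lambda>i. complex_of_real (p i))"
      unfolding p_def by (rule real_diagonal_mat[OF s(1) \<sigma>(2)]) (rule s(2))
    show ?thesis
    proof (cases "\<forall>v \<in> carrier_vec n. \<sigma> *\<^sub>v v = 0\<^sub>v n \<longrightarrow> \<rho> *\<^sub>v v = 0\<^sub>v n")
      case False
      then show ?thesis unfolding rel_entropy_def dim by auto
    next
      case True
      \<comment> \<open>Where \<open>p i = 0\<close>, the \<open>i\<close>-th unit vector lies in
        the kernel of \<open>\<sigma>\<close>, hence in that of \<open>\<rho>\<close>. This is the
        support hypothesis of \<open>gibbs_inequality\<close>.\<close>
      have zero: "Re (\<rho> $$ (i, i)) = 0" if i: "i < n" "p i = 0" for i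
      proof -
        have "\<sigma> *\<^sub>v unit_vec n i = 0\<^sub>v n"
          using i by (subst sp, intro eq_vecI) (auto simp: mat_diag_def)
        then have "(\<rho> *\<^sub>v unit_vec n i) $ i = 0" using True i by auto
        then show ?thesis using r(1) i by simp
      qed
      have "(\<Sum>i<n. Re (\<rho> $$ (i, i)) * log 2 (p i))
          \<le> (\<Sum>i<n. Re (\<rho> $$ (i, i)) * log 2 (Re (\<rho> $$ (i, i))))"
        by (rule gibbs_inequality) (use r(3,5) s(3,5) zero in \<open>simp_all add: p_def\<close>)
      then show ?thesis
        using rel_entropy_mat_diag[OF \<rho>, of p, OF zero] by (simp add: sp[symmetric] eta_def sum_negf)
    qed
  qed
  have "rel_entropy \<rho> (mat_diag n (\<lambda>i. complex_of_real (Re (\<rho> $$ (i, i))))) = ?c"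
    using rel_entropy_mat_diag[OF \<rho>, of "\<lambda>i. Re (\<rho> $$ (i, i))"] by (simp add: eta_def sum_negf)
  then show ?thesis
    unfolding rel_ent_coherence_def dim
    using lower dephased_in_incoherent_states[OF \<rho>]
    by (intro antisym INF_greatest) (auto intro: INF_lower2)
qed

lemma rel_ent_coherence_incoherent:
  assumes "\<rho> \<in> states n" "diagonal_mat \<rho>"
  shows "rel_ent_coherence \<rho> = 0"
proof -
  note r = state_diag[OF assms(1)]
  have "\<rho> = mat_diag n (\<lambda>i. complex_of_real (Re (\<rho> $$ (i, i))))"
    by (rule real_diagonal_mat[OF r(1) assms(2)]) (rule r(2))
  then have "vN_entropy \<rho> = (\<Sum>i<n. eta (Re (\<rho> $$ (i, i))))"
    using vN_entropy_mat_diag by metis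
  then show ?thesis by (simp add: rel_ent_coherence_eq[OF assms(1)])
qed

lemma vN_entropy_nonneg:
  assumes "\<rho> \<in> states n"
  shows "0 \<le> vN_entropy \<rho>"
proof -
  obtain U d where U: "unitary n U"
    and dec: "\<rho> = U * mat_diag n (\<lambda>i. complex_of_real (d i)) * mat_adjoint U"
    and d: "\<And>k. k < n \<Longrightarrow> 0 \<le> d k" "(\<Sum>k<n. d k) = 1"
    using state_spectral_decomposition[OF assms] by metis
  have "d k \<le> 1" if "k < n" for k
    using member_le_sum[of k "{..<n}" d] d that by auto
  then show ?thesis
    unfolding vN_entropy_unitary_conj_diag[OF U dec] using d by (intro sum_nonneg eta_nonneg) auto
qed

section \<open>Entropy bound for arbitrary ensembles\<close>

lemma unitary_parseval:
  assumes "unitary n U"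
  shows "(\<Sum>k<n. (cmod (\<Sum>a<n. cnj (U $$ (a, k)) * x a))\<^sup>2) = (\<Sum>a<n. (cmod (x a))\<^sup>2)"
proof -
  have "complex_of_real (\<Sum>k<n. (cmod (\<Sum>a<n. cnj (U $$ (a, k)) * x a))\<^sup>2)
      = (\<Sum>k<n. \<Sum>a<n. \<Sum>b<n. (cnj (U $$ (a, k)) * x a) * cnj (cnj (U $$ (b, k)) * x b))"
    unfolding of_real_sum mult_cnj_cmod[symmetric] cnj_sum sum_product ..
  also have "\<dots> = (\<Sum>a<n. \<Sum>b<n. \<Sum>k<n. (cnj (U $$ (a, k)) * x a) * cnj (cnj (U $$ (b, k)) * x b))"
    by (subst sum.swap, rule sum.cong[OF refl], rule sum.swap)
  also have "\<dots> = (\<Sum>a<n. \<Sum>b<n. x a * cnj (x b) * (\<Sum>k<n. U $$ (b, k) * cnj (U $$ (a, k))))"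
    by (auto simp: sum_distrib_left intro!: sum.cong)
  also have "\<dots> = (\<Sum>a<n. \<Sum>b<n. if b = a then complex_of_real ((cmod (x a))\<^sup>2) else 0)"
    by (intro sum.cong refl) (auto simp: unitary_rows[OF assms] mult_cnj_cmod)
  also have "\<dots> = complex_of_real (\<Sum>a<n. (cmod (x a))\<^sup>2)" by simp
  finally show ?thesis using of_real_eq_iff by blast
qed

text \<open>Expand the vectors \<open>w m\<close>, scaled by \<open>sqrt (c m)\<close>, in an
  eigenbasis of \<open>\<rho>\<close>, with coefficients \<open>b k m\<close>. The rows, one per
  eigenvector, are orthogonal with squared norms \<open>d k\<close>; the columns have the ensemble
  weights as squared norms. Bessel's inequality for the rows and
  \<open>sum_eta_le_of_substochastic\<close> compare the two entropies.\<close>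

lemma vN_entropy_le_ensemble:
  assumes e: "ensemble n J c w \<rho>" and fin: "finite J" and c: "\<And>m. m \<in> J \<Longrightarrow> 0 \<le> c m"
  shows "vN_entropy \<rho> \<le> (\<Sum>m\<in>J. eta (c m * (\<Sum>i<n. (cmod (w m i))\<^sup>2)))"
proof -
  note r = ensembleD[OF e]
  obtain U d where U: "unitary n U"
    and dec: "\<rho> = U * mat_diag n (\<lambda>i. complex_of_real (d i)) * mat_adjoint U"
    using hermitian_diagonalizable[OF r(1) ensemble_hermitian[OF e]] by blast
  note eU = ensembleD(2)[OF unitary_conj_diag_ensemble[OF U dec]]
  define y where "y k m = (\<Sum>a<n. cnj (U $$ (a, k)) * w m a)" for k m
  define b where "b k m = complex_of_real (sqrt (c m)) * y k m" for k m
  \<comment> \<open>The inner product of rows \<open>k\<close> and \<open>l\<close> is the matrix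
    element of \<open>\<rho>\<close> between eigenvectors \<open>k\<close> and \<open>l\<close>: the
    chain first collects the ensemble into \<open>\<rho>\<close> and then expands
    \<open>\<rho>\<close> spectrally.\<close>
  have gram: "(\<Sum>m\<in>J. b k m * cnj (b l m)) = (if k = l then complex_of_real (d k) else 0)"
    if k: "k < n" and l: "l < n" for k l
  proof -
    have "(\<Sum>m\<in>J. b k m * cnj (b l m))
        = (\<Sum>m\<in>J. complex_of_real (c m) * (y k m * cnj (y l m)))"
    proof (intro sum.cong refl)
      fix m assume "m \<in> J"
      then have "complex_of_real (c m) = complex_of_real (sqrt (c m)) * complex_of_real (sqrt (c m))"
        using c by (simp flip: of_real_mult)
      then show "b k m * cnj (b l m) = complex_of_real (c m) * (y k m * cnj (y l m))"
        by (simp add: b_def)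
    qed
    also have "\<dots> = (\<Sum>m\<in>J. \<Sum>a<n. \<Sum>a'<n. complex_of_real (c m)
        * ((cnj (U $$ (a, k)) * w m a) * cnj (cnj (U $$ (a', l)) * w m a')))"
      unfolding y_def cnj_sum sum_product unfolding sum_distrib_left ..
    also have "\<dots> = (\<Sum>a<n. \<Sum>a'<n. \<Sum>m\<in>J. complex_of_real (c m)
        * ((cnj (U $$ (a, k)) * w m a) * cnj (cnj (U $$ (a', l)) * w m a')))"
      by (subst sum.swap, rule sum.cong[OF refl], rule sum.swap)
    also have "\<dots> = (\<Sum>a<n. \<Sum>a'<n. cnj (U $$ (a, k)) * \<rho> $$ (a, a') * U $$ (a', l))"
      by (auto simp: r(2) sum_distrib_left sum_distrib_right intro!: sum.cong)
    also have "\<dots> = (\<Sum>a<n. \<Sum>a'<n. \<Sum>p<n. complex_of_real (d p)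
        * ((cnj (U $$ (a, k)) * U $$ (a, p)) * (cnj (U $$ (a', p)) * U $$ (a', l))))"
      by (auto simp: eU sum_distrib_left sum_distrib_right intro!: sum.cong)
    also have "\<dots> = (\<Sum>p<n. \<Sum>a<n. \<Sum>a'<n. complex_of_real (d p)
        * ((cnj (U $$ (a, k)) * U $$ (a, p)) * (cnj (U $$ (a', p)) * U $$ (a', l))))"
      by (subst (2) sum.swap, subst sum.swap) simp
    also have "\<dots> = (\<Sum>p<n. complex_of_real (d p)
        * ((\<Sum>a<n. cnj (U $$ (a, k)) * U $$ (a, p)) * (\<Sum>a'<n. cnj (U $$ (a', p)) * U $$ (a', l))))"
      unfolding sum_product unfolding sum_distrib_left ..
    also have "\<dots> = (\<Sum>p<n. if p = k then if k = l then complex_of_real (d k) else 0 else 0)"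
      using k l by (intro sum.cong refl) (auto simp: unitary_columns[OF U])
    finally show ?thesis using k by simp
  qed
  have dk: "(\<Sum>m\<in>J. (cmod (b k m))\<^sup>2) = d k" if "k < n" for k
  proof -
    have "complex_of_real (\<Sum>m\<in>J. (cmod (b k m))\<^sup>2) = complex_of_real (d k)"
      unfolding of_real_sum mult_cnj_cmod[symmetric] using gram[OF that that] by simp
    then show ?thesis using of_real_eq_iff by blast
  qed
  have qm: "(\<Sum>k<n. (cmod (b k m))\<^sup>2) = c m * (\<Sum>i<n. (cmod (w m i))\<^sup>2)" if "m \<in> J" for m
    using c[OF that] unitary_parseval[OF U, of "w m"]
    by (simp add: b_def y_def norm_mult power_mult_distrib flip: sum_distrib_left)
  have "vN_entropy \<rho> = (\<Sum>k<n. eta (\<Sum>m\<in>J. (cmod (b k m))\<^sup>2))"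
    by (simp add: vN_entropy_unitary_conj_diag[OF U dec] dk)
  also have "\<dots> \<le> (\<Sum>m\<in>J. eta (\<Sum>k<n. (cmod (b k m))\<^sup>2))"
    using fin by (intro sum_eta_le_of_substochastic bessel_orthogonal_rows) (auto simp: gram)
  finally show ?thesis by (simp add: qm)
qed

section \<open>The erasing channel\<close>

lemma sum_lessThan_add:
  fixes f :: "nat \<Rightarrow> 'a::comm_monoid_add"
  shows "(\<Sum>i<m + k. f i) = (\<Sum>i<m. f i) + (\<Sum>i<k. f (m + i))"
  by (induction k) (simp_all add: add.assoc)

text \<open>With index \<open>a * k + b\<close>, the indices below \<open>k\<close> are those with
  \<open>a = 0\<close>. The output lives on this block alone and holds there the partial trace over
  the qubit, the sum of the two diagonal blocks.\<close>

lemma index_tensor_id_erasing: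
  assumes "i < 2 * k" "j < 2 * k"
  shows "tensor_id 2 k erasing_channel \<rho> $$ (i, j)
    = (if i < k \<and> j < k then \<rho> $$ (i, j) + \<rho> $$ (k + i, k + j) else 0)"
proof -
  have k: "0 < k" using assms by auto
  have div: "i div k < 2" "j div k < 2" using assms by (simp_all add: less_mult_imp_div_less)
  have "mat_trace (block_B 2 k \<rho> (i mod k) (j mod k))
      = \<rho> $$ (i mod k, j mod k) + \<rho> $$ (k + i mod k, k + j mod k)"
    by (simp add: mat_trace_def block_B_def numeral_2_eq_2)
  moreover have "i div k = 0 \<longleftrightarrow> i < k" "j div k = 0 \<longleftrightarrow> j < k"
    using k by (simp_all add: div_eq_0_iff)
  ultimately show ?thesis
    using assms div by (auto simp: tensor_id_def erasing_channel_def)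
qed

text \<open>Tracing out the qubit cuts each \<open>w m\<close> into its halves \<open>s = 0\<close>
  and \<open>s = 1\<close>; the erased qubit places both halves in the first block, padded with
  zeros.\<close>

lemma tensor_id_erasing_ensemble:
  assumes "ensemble (2 * k) {..<n} d w \<rho>"
  shows "ensemble (2 * k) ({..<n} \<times> {..<2}) (\<lambda>(m, s). d m)
    (\<lambda>(m, s) i. if i < k then w m (s * k + i) else 0) (tensor_id 2 k erasing_channel \<rho>)"
  unfolding ensemble_def
proof (intro conjI allI impI)
  show "tensor_id 2 k erasing_channel \<rho> \<in> carrier_mat (2 * k) (2 * k)"
    by (simp add: tensor_id_def)
next
  fix i j assume ij: "i < 2 * k" "j < 2 * k"
  show "tensor_id 2 k erasing_channel \<rho> $$ (i, j)
    = (\<Sum>x\<in>{..<n} \<times> {..<2}. complex_of_real (case x of (m, s) \<Rightarrow> d m)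
        * (case x of (m, s) \<Rightarrow> \<lambda>i. if i < k then w m (s * k + i) else 0) i
        * cnj ((case x of (m, s) \<Rightarrow> \<lambda>i. if i < k then w m (s * k + i) else 0) j))"
    unfolding index_tensor_id_erasing[OF ij]
    by (auto simp: ensembleD(2)[OF assms] numeral_2_eq_2 sum.cartesian_product' sum.distrib)
qed

lemma tensor_id_erasing:
  assumes \<rho>: "\<rho> \<in> states (2 * k)"
  shows "tensor_id 2 k erasing_channel \<rho> \<in> states (2 * k)"
    "vN_entropy (tensor_id 2 k erasing_channel \<rho>) \<le> vN_entropy \<rho> + 1"
proof -
  obtain U d where U: "unitary (2 * k) U"
    and dec: "\<rho> = U * mat_diag (2 * k) (\<lambda>i. complex_of_real (d i)) * mat_adjoint U"
    and d: "\<And>m. m < 2 * k \<Longrightarrow> 0 \<le> d m" "(\<Sum>m<2 * k. d m) = 1"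
    using state_spectral_decomposition[OF \<rho>] by metis
  note e = tensor_id_erasing_ensemble[OF unitary_conj_diag_ensemble[OF U dec]]
  \<comment> \<open>\<open>p m s\<close> is the weight of half \<open>s\<close> of the
    \<open>m\<close>-th eigenvector; the two halves share the weight \<open>d m\<close>.\<close>
  define p where "p m s = d m * (\<Sum>i<k. (cmod (U $$ (s * k + i, m)))\<^sup>2)" for m s
  have norm: "d m * (\<Sum>i<2 * k. (cmod (if i < k then U $$ (s * k + i, m) else 0))\<^sup>2) = p m s" for m s
    using sum_lessThan_add[of "\<lambda>i. (cmod (if i < k then U $$ (s * k + i, m) else 0))\<^sup>2" k k]
    by (simp add: p_def mult_2)
  have p_sum: "p m 0 + p m 1 = d m" if "m < 2 * k" for m
    using unitary_column_norm[OF U that] sum_lessThan_add[of "\<lambda>i. (cmod (U $$ (i, m)))\<^sup>2" k k]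
    by (simp add: p_def mult_2 flip: distrib_left)
  have p: "0 \<le> p m s" if "m < 2 * k" for m s
    unfolding p_def using d(1)[OF that] by (intro mult_nonneg_nonneg sum_nonneg) auto
  have two: "(\<Sum>x\<in>{..<2 * k} \<times> {..<2::nat}. f (case x of (m, s) \<Rightarrow> p m s))
      = (\<Sum>m<2 * k. f (p m 0) + f (p m 1))" for f :: "real \<Rightarrow> real"
    by (simp add: sum.cartesian_product' numeral_2_eq_2)
  have norm': "(case x of (m, s) \<Rightarrow> d m)
      * (\<Sum>i<2 * k. (cmod ((case x of (m, s) \<Rightarrow> \<lambda>i. if i < k then U $$ (s * k + i, m) else 0) i))\<^sup>2)
      = (case x of (m, s) \<Rightarrow> p m s)" for x
    by (cases x) (simp only: prod.case norm)
  show "tensor_id 2 k erasing_channel \<rho> \<in> states (2 * k)"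
  proof (rule ensemble_in_states[OF e])
    show "(\<Sum>x\<in>{..<2 * k} \<times> {..<2::nat}. (case x of (m, s) \<Rightarrow> d m)
      * (\<Sum>i<2 * k. (cmod ((case x of (m, s) \<Rightarrow> \<lambda>i. if i < k then U $$ (s * k + i, m) else 0) i))\<^sup>2)) = 1"
      unfolding norm' two[of "\<lambda>x. x"] using p_sum d(2) by simp
  qed (use d in auto)
  have "vN_entropy (tensor_id 2 k erasing_channel \<rho>)
      \<le> (\<Sum>x\<in>{..<2 * k} \<times> {..<2::nat}. eta (case x of (m, s) \<Rightarrow> p m s))"
    unfolding norm'[symmetric] by (rule vN_entropy_le_ensemble[OF e]) (use d in auto)
  also have "\<dots> = (\<Sum>m<2 * k. eta (p m 0) + eta (p m 1))" by (rule two)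
  also have "\<dots> \<le> (\<Sum>m<2 * k. eta (d m) + d m)"
  proof (rule sum_mono)
    fix m assume "m \<in> {..<2 * k}"
    then have m: "m < 2 * k" by simp
    show "eta (p m 0) + eta (p m 1) \<le> eta (d m) + d m"
      using eta_add_le[OF p[OF m] p[OF m], of 0 1] by (simp only: p_sum[OF m])
  qed
  also have "\<dots> = vN_entropy \<rho> + 1"
    by (simp add: sum.distrib d(2) vN_entropy_unitary_conj_diag[OF U dec])
  finally show "vN_entropy (tensor_id 2 k erasing_channel \<rho>) \<le> vN_entropy \<rho> + 1" .
qed

text \<open>One bit is lost on the diagonal, where the entries \<open>i\<close> and
  \<open>k + i\<close> merge, and one bit is the entropy gain from \<open>tensor_id_erasing\<close>.
  Neither depends on \<open>k\<close>.\<close>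

lemma coherence_loss_tensor_id_erasing_le:
  assumes \<rho>: "\<rho> \<in> states (2 * k)"
  shows "rel_ent_coherence \<rho> - rel_ent_coherence (tensor_id 2 k erasing_channel \<rho>) \<le> 2"
proof -
  let ?\<tau> = "tensor_id 2 k erasing_channel \<rho>"
  note r = state_diag[OF \<rho>] and t = tensor_id_erasing[OF \<rho>]
  let ?x = "\<lambda>i. Re (\<rho> $$ (i, i))"
  have "(\<Sum>i<2 * k. eta (?x i)) = (\<Sum>i<k. eta (?x i) + eta (?x (k + i)))"
    using sum_lessThan_add[of "\<lambda>i. eta (?x i)" k k] by (simp add: mult_2 sum.distrib)
  also have "\<dots> \<le> (\<Sum>i<k. eta (?x i + ?x (k + i)) + (?x i + ?x (k + i)))"
    by (intro sum_mono eta_add_le) (use r(3) in auto)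
  also have "\<dots> = (\<Sum>i<k. eta (?x i + ?x (k + i))) + (\<Sum>i<2 * k. ?x i)"
    using sum_lessThan_add[of ?x k k] by (simp add: mult_2 sum.distrib)
  \<comment> \<open>The output diagonal vanishes from index \<open>k\<close> on, where each term is
    \<open>eta 0 = 0\<close>.\<close>
  also have "(\<Sum>i<k. eta (?x i + ?x (k + i))) = (\<Sum>i<2 * k. eta (Re (?\<tau> $$ (i, i))))"
    using sum_lessThan_add[of "\<lambda>i. eta (Re (?\<tau> $$ (i, i)))" k k]
    by (simp add: index_tensor_id_erasing flip: mult_2)
  finally have "(\<Sum>i<2 * k. eta (?x i)) \<le> (\<Sum>i<2 * k. eta (Re (?\<tau> $$ (i, i)))) + 1"
    by (simp only: r(5))
  then have "((\<Sum>i<2 * k. eta (?x i)) - vN_entropy \<rho>)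
      - ((\<Sum>i<2 * k. eta (Re (?\<tau> $$ (i, i)))) - vN_entropy ?\<tau>) \<le> 2"
    using t(2) by linarith
  then show ?thesis
    by (simp add: rel_ent_coherence_eq[OF \<rho>] rel_ent_coherence_eq[OF t(1)])
qed

section \<open>Values of the two decohering powers\<close>

lemma rel_ent_coherence_erasing_channel:
  assumes "\<rho> \<in> states 2"
  shows "rel_ent_coherence (erasing_channel \<rho>) = 0"
proof (rule rel_ent_coherence_incoherent)
  have eq: "erasing_channel \<rho> = Matrix.mat 2 2 (\<lambda>(i, j). if i = 0 \<and> j = 0 then 1 else 0)"
    using assms by (auto simp: erasing_channel_def states_def)
  have "ensemble 2 {()} (\<lambda>_. 1) (\<lambda>_ i. if i = 0 then 1 else 0) (erasing_channel \<rho>)"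
    unfolding eq by (auto simp: ensemble_def)
  then show "erasing_channel \<rho> \<in> states 2"
    by (rule ensemble_in_states) (auto simp: numeral_2_eq_2)
  show "diagonal_mat (erasing_channel \<rho>)" unfolding eq by (auto simp: diagonal_mat_def)
qed

text \<open>A single vector of total weight 1 is an ensemble, so the entropy is at most
  \<open>eta 1 = 0\<close>, and equal moduli make the diagonal uniform, of entropy
  \<open>log 2 n\<close>. The phases \<open>s\<close> affect neither quantity and stay free to shape
  the partial trace.\<close>

lemma coherence_flat_pure_state:
  fixes s :: "nat \<Rightarrow> complex"
  assumes n: "0 < n" and s: "\<And>i. i < n \<Longrightarrow> cmod (s i) = 1"
    and \<rho>: "\<rho> = Matrix.mat n n (\<lambda>(i, j). s i * cnj (s j) / of_nat n)"
  shows "\<rho> \<in> states n" "ereal (log 2 n) \<le> rel_ent_coherence \<rho>"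
proof -
  have e: "ensemble n {()} (\<lambda>_. 1 / real n) (\<lambda>_. s) \<rho>"
    unfolding \<rho> by (auto simp: ensemble_def)
  have norm: "(\<Sum>i<n. (cmod (s i))\<^sup>2) = real n" using s by simp
  show st: "\<rho> \<in> states n"
    by (rule ensemble_in_states[OF e]) (use n norm in auto)
  have "vN_entropy \<rho> \<le> 0"
    using vN_entropy_le_ensemble[OF e] n by (simp add: norm)
  moreover have "Re (\<rho> $$ (i, i)) = 1 / real n" if "i < n" for i
    using ensemble_diag[OF e that] s[OF that] by simp
  then have "(\<Sum>i<n. eta (Re (\<rho> $$ (i, i)))) = log 2 n"
    using n by (simp add: eta_def log_divide)
  ultimately show "ereal (log 2 n) \<le> rel_ent_coherence \<rho>"
    by (simp add: rel_ent_coherence_eq[OF st])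
qed

lemma gen_decohering_power_erasing: "gen_decohering_power 2 erasing_channel = 1"
proof (rule antisym)
  show "gen_decohering_power 2 erasing_channel \<le> 1"
    unfolding gen_decohering_power_def
  proof (rule SUP_least)
    fix \<rho> assume \<rho>: "\<rho> \<in> states 2"
    note r = state_diag[OF \<rho>]
    \<comment> \<open>The two diagonal entries sum to 1, so the bound of \<open>eta_add_le\<close>
      is \<open>eta 1 + 1 = 1\<close>.\<close>
    have "eta (Re (\<rho> $$ (0, 0))) + eta (Re (\<rho> $$ (1, 1))) \<le> 1"
      using eta_add_le[OF r(3) r(3), of 0 1] r(5) by (simp add: numeral_2_eq_2)
    then have "(\<Sum>i<2. eta (Re (\<rho> $$ (i, i)))) - vN_entropy \<rho> \<le> 1"
      using vN_entropy_nonneg[OF \<rho>] by (simp add: numeral_2_eq_2)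
    then show "rel_ent_coherence \<rho> - rel_ent_coherence (erasing_channel \<rho>) \<le> 1"
      by (simp add: rel_ent_coherence_eq[OF \<rho>] rel_ent_coherence_erasing_channel[OF \<rho>] one_ereal_def)
  qed
next
  \<comment> \<open>The uniform superposition has coherence \<open>log 2 2 = 1\<close>, and none of
    it survives the erasure.\<close>
  define \<rho> :: "complex mat" where "\<rho> = Matrix.mat 2 2 (\<lambda>(i, j). 1 * cnj 1 / of_nat 2)"
  have \<rho>: "\<rho> \<in> states 2" "ereal (log 2 (real 2)) \<le> rel_ent_coherence \<rho>"
    by (rule coherence_flat_pure_state[where s = "\<lambda>_. 1"]; simp add: \<rho>_def)+
  then show "1 \<le> gen_decohering_power 2 erasing_channel"
    unfolding gen_decohering_power_def
    by (intro SUP_upper2[OF \<rho>(1)]) (simp add: rel_ent_coherence_erasing_channel one_ereal_def)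
qed

lemma complete_decohering_power_erasing: "complete_decohering_power 2 erasing_channel = 2"
proof (rule antisym)
  show "complete_decohering_power 2 erasing_channel \<le> 2"
    unfolding complete_decohering_power_def
    by (intro SUP_least coherence_loss_tensor_id_erasing_le)
next
  \<comment> \<open>Index 3 is the basis vector with both bits equal to 1. With the sign there, the
    halves \<open>(1, 1)\<close> and \<open>(1, -1)\<close> are orthogonal and of equal norm, which
    makes the vector maximally entangled.\<close>
  define s :: "nat \<Rightarrow> complex" where "s i = (if i = 3 then -1 else 1)" for i
  define \<rho> where "\<rho> = Matrix.mat 4 4 (\<lambda>(i, j). s i * cnj (s j) / of_nat 4)"
  have \<rho>: "\<rho> \<in> states 4" "ereal (log 2 (real 4)) \<le> rel_ent_coherence \<rho>"
    by (rule coherence_flat_pure_state[where s = s]; simp add: \<rho>_def s_def)+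
  have l: "log 2 (4::real) = 2"
    using log_pow_cancel[of "2::real" 2] by simp
  have st: "tensor_id 2 2 erasing_channel \<rho> \<in> states (2 * 2)"
    using tensor_id_erasing(1)[of \<rho> 2] \<rho>(1) by simp
  moreover have "diagonal_mat (tensor_id 2 2 erasing_channel \<rho>)"
    unfolding diagonal_mat_def
  proof (intro allI impI)
    fix i j assume "i < dim_row (tensor_id 2 2 erasing_channel \<rho>)"
      "j < dim_col (tensor_id 2 2 erasing_channel \<rho>)" "i \<noteq> j"
    then have ij: "i < 2 * 2" "j < 2 * 2" "i \<noteq> j" by (auto simp: tensor_id_def)
    \<comment> \<open>Inside the first block, the off-diagonal entries \<open>1/4\<close> and
      \<open>-1/4\<close> of the two diagonal blocks of \<open>\<rho>\<close> cancel in the partial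
      trace.\<close>
    show "tensor_id 2 2 erasing_channel \<rho> $$ (i, j) = 0"
      unfolding index_tensor_id_erasing[OF ij(1,2)] using ij(3)
      by (auto simp: \<rho>_def s_def less_Suc_eq numeral_2_eq_2 numeral_3_eq_3)
  qed
  ultimately have zero: "rel_ent_coherence (tensor_id 2 2 erasing_channel \<rho>) = 0"
    by (rule rel_ent_coherence_incoherent)
  have "2 \<le> rel_ent_coherence \<rho> - rel_ent_coherence (tensor_id 2 2 erasing_channel \<rho>)"
    using \<rho>(2) by (simp add: zero l)
  then show "2 \<le> complete_decohering_power 2 erasing_channel"
    unfolding complete_decohering_power_def using \<rho>(1)
    \<comment> \<open>An auxiliary qubit, \<open>k = 2\<close>, already reaches the
      supremum.\<close>
    by (intro SUP_upper2[of 2] SUP_upper2[of \<rho>]) simp_all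
qed

theorem mainTheorem3:
  shows "complete_decohering_power 2 erasing_channel = 2 \<and>
    gen_decohering_power 2 erasing_channel = 1 \<and>
    gen_decohering_power 2 erasing_channel < complete_decohering_power 2 erasing_channel"
  by (simp add: complete_decohering_power_erasing gen_decohering_power_erasing)

end
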